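(* Let $G$ be a graph of order $n$ with chromatic number $\chi(G)=k$. Then $\tau(G) \leq k(f(n/k)+1)-1$. Moreover, this bound is sharp for all $k$: for every integer $k\geq 1$ there exist an integer $n$ and a graph $G$ of order $n$ with $\chi(G)=k$ such that $\tau(G)=k(f(n/k)+1)-1$.
   Context: Graphs are finite, simple, undirected and have at least one vertex; the order of a graph is its number of vertices; $d_G(x,y)$ is the distance between $x$ and $y$ in $G$ (equal to $\infty$ if $x$ and $y$ lie in different components). A vertex $w$ resolves a pair of vertices $u,v$ if $d_G(u,w)\neq d_G(v,w)$. A set $W\subseteq V(G)$ is a resolving set for $G$ if every pair of distinct vertices of $G$ is resolved by some vertex of $W$. The metric dimension $\beta(G)$ is the minimum cardinality of a resolving set for $G$ (with $\beta(K_1)=0$). The threshold dimension is $\tau(G)=\min\{\beta(H): H \text{ contains } G \text{ as a spanning subgraph}\}$, i.e. the minimum metric dimension among all graphs $H$ with $V(H)=V(G)$ and $E(G)\subseteq E(H)$. The function $f:[1,\infty)\to\mathbb{N}$ is defined by letting $f(x)$ be the smallest integer $d$ such that $2^d+d>x$; equivalently, $f(x)=d$ if and only if $x\in[2^{d-1}+d-1,\,2^d+d)$, where $d\ge 1$. *)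

theory Defs
  imports Complex_Main "Graph_Theory.Graph_Theory"
begin

text \<open>An undirected edge is represented by the two arcs between its end vertices.\<close>

definition simple_graph :: "'a pair_pre_digraph \<Rightarrow> bool" where
  "simple_graph G \<longleftrightarrow> pair_graph G \<and> pverts G \<noteq> {}"

definition order_of :: "'a pair_pre_digraph \<Rightarrow> nat" where
  "order_of G = card (pverts G)"

definition proper_coloring :: "'a pair_pre_digraph \<Rightarrow> nat \<Rightarrow> ('a \<Rightarrow> nat) \<Rightarrow> bool" where
  "proper_coloring G k c \<longleftrightarrow>
     c ` pverts G \<subseteq> {..<k} \<and> (\<forall>(u, v) \<in> parcs G. c u \<noteq> c v)"

definition chromatic_number :: "'a pair_pre_digraph \<Rightarrow> nat" where
  "chromatic_number G = (LEAST k. \<exists>c. proper_coloring G k c)"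

text \<open>The infimum over an empty set of walks is \<open>\<infinity>\<close>, so vertices in different components
  are at distance \<open>\<infinity>\<close>.\<close>

definition gdist :: "'a pair_pre_digraph \<Rightarrow> 'a \<Rightarrow> 'a \<Rightarrow> ereal" where
  "gdist G u v = wf_digraph.\<mu> (with_proj G) (\<lambda>_. 1) u v"

definition resolves :: "'a pair_pre_digraph \<Rightarrow> 'a \<Rightarrow> 'a \<Rightarrow> 'a \<Rightarrow> bool" where
  "resolves G w u v \<longleftrightarrow> gdist G u w \<noteq> gdist G v w"

definition resolving_set :: "'a pair_pre_digraph \<Rightarrow> 'a set \<Rightarrow> bool" where
  "resolving_set G W \<longleftrightarrow> W \<subseteq> pverts G \<and>
     (\<forall>u \<in> pverts G. \<forall>v \<in> pverts G. u \<noteq> v \<longrightarrow> (\<exists>w \<in> W. resolves G w u v))"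

definition metric_dimension :: "'a pair_pre_digraph \<Rightarrow> nat" where
  "metric_dimension G = (LEAST m. \<exists>W. resolving_set G W \<and> card W = m)"

definition threshold_dimension :: "'a pair_pre_digraph \<Rightarrow> nat" where
  "threshold_dimension G =
     (LEAST m. \<exists>H. simple_graph H \<and> spanning (with_proj G) (with_proj H) \<and>
                   metric_dimension H = m)"

text \<open>Only arguments \<open>x \<ge> 1\<close> matter; for these, no negative integer \<open>d\<close> satisfies the
  inequality, so minimizing over the natural numbers is minimizing over the integers.\<close>

definition f_threshold :: "real \<Rightarrow> nat" where
  "f_threshold x = (LEAST d. 2 ^ d + real d > x)"

end

theory Submission
  imports Defs
begin

text \<open>Upper bound: in each class \<open>V\<^sub>i\<close> of an optimal colouring choose a set \<open>W\<^sub>i\<close> of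
  \<open>f |V\<^sub>i|\<close> landmarks. Join all pairs of vertices from different classes, and give the remaining
  vertices of \<open>V\<^sub>i\<close>, of which there are fewer than \<open>2 ^ |W\<^sub>i|\<close>, distinct proper subsets of \<open>W\<^sub>i\<close> as
  neighbourhoods. Properness separates vertices of different classes, since a vertex outside \<open>V\<^sub>i\<close>
  is adjacent to all of \<open>W\<^sub>i\<close>. So the threshold dimension is at most the sum of the \<open>f |V\<^sub>i|\<close>, and
  since \<open>|V\<^sub>i| \<ge> 2 ^ a + a\<close> for \<open>a = f |V\<^sub>i| - 1\<close>, convexity of \<open>2 ^ a + a\<close> bounds this sum.

  Sharpness: in any supergraph of a complete \<open>k\<close>-partite graph, \<open>k \<ge> 2\<close>, a vertex resolves two vertices of
  one part only if it lies in that part, and distances within a part are 1 or 2. Hence a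
  part \<open>A\<close> satisfies \<open>|A| \<le> 2 ^ w + w\<close>, where \<open>w\<close> counts the landmarks in \<open>A\<close>. Taking \<open>k - 1\<close> parts
  of size \<open>2 ^ k + k + 1\<close> forces \<open>k + 1\<close> landmarks in each of them, and a last part
  of size \<open>2 ^ (k - 1) + k\<close> forces \<open>k\<close> more.\<close>

section \<open>Distances at most two\<close>

lemma simple_graphD:
  assumes "simple_graph G"
  shows "wf_digraph (with_proj G)" "finite (pverts G)" "pverts G \<noteq> {}"
    "\<And>u v. (u, v) \<in> parcs G \<Longrightarrow> u \<in> pverts G"
    "\<And>u v. (u, v) \<in> parcs G \<Longrightarrow> v \<in> pverts G"
    "\<And>u v. (u, v) \<in> parcs G \<Longrightarrow> u \<noteq> v"
    "\<And>u v. (u, v) \<in> parcs G \<Longrightarrow> (v, u) \<in> parcs G"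
proof -
  interpret pair_graph G using assms by (simp add: simple_graph_def)
  show "wf_digraph (with_proj G)" by unfold_locales
  show "finite (pverts G)" by (rule pair_finite_verts)
  show "pverts G \<noteq> {}" using assms by (simp add: simple_graph_def)
  show "\<And>u v. (u, v) \<in> parcs G \<Longrightarrow> u \<in> pverts G" by (rule in_arcsD1)
  show "\<And>u v. (u, v) \<in> parcs G \<Longrightarrow> v \<in> pverts G" by (rule in_arcsD2)
  show "\<And>u v. (u, v) \<in> parcs G \<Longrightarrow> u \<noteq> v" by (rule no_loops')
  show "\<And>u v. (u, v) \<in> parcs G \<Longrightarrow> (v, u) \<in> parcs G" by (rule arcs_symmetric)
qed

lemma simple_graphI:
  assumes "finite (pverts G)" "pverts G \<noteq> {}"
    and "\<And>u v. (u, v) \<in> parcs G \<Longrightarrow> u \<in> pverts G \<and> v \<in> pverts G \<and> u \<noteq> v \<and> (v, u) \<in> parcs G"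
  shows "simple_graph G"
proof -
  have "finite (parcs G)"
    by (rule finite_subset[of _ "pverts G \<times> pverts G"]) (use assms in auto)
  moreover have "symmetric (with_proj G)"
    using assms(3) by (auto simp: symmetric_def sym_def)
  ultimately have "pair_graph G"
    by unfold_locales (use assms in \<open>auto dest: assms(3)\<close>)
  with assms(2) show ?thesis by (simp add: simple_graph_def)
qed

text \<open>With unit weights the cost of a walk is its length, so distances can be bounded through
  lists of arcs alone. If there is no walk, both sides are infinite.\<close>

lemma gdist_eq_INF_length:
  assumes "simple_graph G"
  shows "gdist G u v =
    (INF p \<in> {p. u \<in> pverts G \<and> set p \<subseteq> parcs G \<and> pcas u p v}. ereal (length p))"
proof -
  interpret wf_digraph "with_proj G" by (rule simple_graphD(1)[OF assms])
  have "awalk_cost (\<lambda>_. 1) p = length p" for p :: "('a \<times> 'a) list"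
    by (induct p) auto
  then show ?thesis
    by (simp add: gdist_def \<mu>_def awalk_def cas_with_proj_eq)
qed

lemma gdist_le:
  assumes "simple_graph G" "u \<in> pverts G" "set p \<subseteq> parcs G" "pcas u p v"
  shows "gdist G u v \<le> length p"
  unfolding gdist_eq_INF_length[OF assms(1)] using assms(2-4) by (auto intro!: INF_lower)

lemma le_gdist:
  fixes d :: real
  assumes "simple_graph G"
    and "\<And>p. set p \<subseteq> parcs G \<Longrightarrow> pcas u p v \<Longrightarrow> d \<le> length p"
  shows "ereal d \<le> gdist G u v"
  unfolding gdist_eq_INF_length[OF assms(1)] using assms(2) by (auto intro!: INF_greatest)

lemma gdist_self:
  assumes "simple_graph G" "u \<in> pverts G"
  shows "gdist G u u = 0"
  using gdist_le[OF assms, of "[]" u] le_gdist[OF assms(1), of u u 0]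
  by (auto simp: zero_ereal_def)

lemma gdist_neq_zero:
  assumes "simple_graph G" "u \<noteq> v"
  shows "gdist G u v \<noteq> 0"
proof -
  have "ereal 1 \<le> gdist G u v"
  proof (rule le_gdist[OF assms(1)])
    fix p assume "pcas u p v"
    with assms(2) show "1 \<le> real (length p)" by (cases p) auto
  qed
  then show ?thesis by (auto simp: zero_ereal_def)
qed

lemma gdist_ge_two:
  assumes "simple_graph G" "u \<noteq> v" "(u, v) \<notin> parcs G"
  shows "2 \<le> gdist G u v"
proof -
  have "ereal 2 \<le> gdist G u v"
  proof (rule le_gdist[OF assms(1)])
    fix p assume p: "set p \<subseteq> parcs G" "pcas u p v"
    with assms(2) obtain e q where "p = e # q" by (cases p) auto
    \<comment> \<open>A single arc from \<open>u\<close> to \<open>v\<close> would be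
      \<open>(u, v)\<close> itself, so a second arc follows.\<close>
    with p assms(3) obtain e' q' where "p = e # e' # q'" by (cases q) auto
    then show "2 \<le> real (length p)" by simp
  qed
  then show ?thesis by simp
qed

lemma gdist_eq_one_iff:
  assumes "simple_graph G" "u \<noteq> v"
  shows "gdist G u v = 1 \<longleftrightarrow> (u, v) \<in> parcs G"
proof
  assume "gdist G u v = 1"
  then show "(u, v) \<in> parcs G"
    using gdist_ge_two[OF assms] by fastforce
next
  assume uv: "(u, v) \<in> parcs G"
  have "ereal 1 \<le> gdist G u v"
  proof (rule le_gdist[OF assms(1)])
    fix p assume "pcas u p v"
    with assms(2) show "1 \<le> real (length p)" by (cases p) auto
  qed
  moreover have "gdist G u v \<le> 1"
    using gdist_le[OF assms(1), of u "[(u, v)]" v] uv simple_graphD(4)[OF assms(1) uv]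
    by (simp add: one_ereal_def)
  ultimately show "gdist G u v = 1" by (simp add: one_ereal_def)
qed

text \<open>For two vertices in one part of a multipartite graph, any vertex of another part serves
  as \<open>x\<close>; distances inside a part then carry no more information than
  adjacency.\<close>

lemma gdist_common_neighbour:
  assumes "simple_graph G" "u \<noteq> v" "(u, x) \<in> parcs G" "(x, v) \<in> parcs G"
  shows "gdist G u v \<in> {1, 2}"
proof (cases "(u, v) \<in> parcs G")
  case True
  then show ?thesis using gdist_eq_one_iff[OF assms(1,2)] by simp
next
  case False
  have "gdist G u v \<le> 2"
    using gdist_le[OF assms(1), of u "[(u, x), (x, v)]" v] assms(3,4)
      simple_graphD(4)[OF assms(1,3)] by simp
  with gdist_ge_two[OF assms(1,2) False] show ?thesis by simp
qed

section \<open>Resolving sets\<close>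

text \<open>A landmark resolves itself from every other vertex, being the only vertex at distance 0
  from it. Outside \<open>W\<close>, adjacency to a landmark means distance 1, so a supergraph can
  be designed by neighbourhoods alone.\<close>

lemma resolving_setI_adjacency:
  assumes G: "simple_graph G" and W: "W \<subseteq> pverts G"
    and adj: "\<And>u v. u \<in> pverts G - W \<Longrightarrow> v \<in> pverts G - W \<Longrightarrow> u \<noteq> v \<Longrightarrow>
      \<exists>w \<in> W. (u, w) \<in> parcs G \<longleftrightarrow> (v, w) \<notin> parcs G"
  shows "resolving_set G W"
  unfolding resolving_set_def resolves_def
proof (intro conjI ballI impI W)
  fix u v assume uv: "u \<in> pverts G" "v \<in> pverts G" "u \<noteq> v"
  consider "u \<in> W" | "v \<in> W" | "u \<notin> W" "v \<notin> W" by blast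
  then show "\<exists>w \<in> W. gdist G u w \<noteq> gdist G v w"
  proof cases
    case 1
    then show ?thesis using gdist_self[OF G uv(1)] gdist_neq_zero[OF G, of v u] uv by metis
  next
    case 2
    then show ?thesis using gdist_self[OF G uv(2)] gdist_neq_zero[OF G, of u v] uv by metis
  next
    case 3
    with adj uv obtain w where w: "w \<in> W" "(u, w) \<in> parcs G \<longleftrightarrow> (v, w) \<notin> parcs G"
      by blast
    with 3 have "u \<noteq> w" "v \<noteq> w" by auto
    with w show ?thesis using gdist_eq_one_iff[OF G] by metis
  qed
qed

lemma metric_dimension_le: "resolving_set G W \<Longrightarrow> metric_dimension G \<le> card W"
  unfolding metric_dimension_def by (auto intro: Least_le)

lemma metric_dimension_attained:
  assumes "simple_graph G"
  obtains W where "resolving_set G W" "card W = metric_dimension G"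
proof -
  have "resolving_set G (pverts G)"
    by (rule resolving_setI_adjacency[OF assms]) auto
  then have "\<exists>m W. resolving_set G W \<and> card W = m" by blast
  from LeastI_ex[OF this] show ?thesis
    using that unfolding metric_dimension_def by blast
qed

lemma spanning_with_proj_iff:
  assumes "simple_graph G" "simple_graph H"
  shows "spanning (with_proj G) (with_proj H) \<longleftrightarrow> pverts H = pverts G \<and> parcs G \<subseteq> parcs H"
  using simple_graphD(1)[OF assms(1)] simple_graphD(1)[OF assms(2)]
  by (auto simp: spanning_def subgraph_def)

lemma threshold_dimension_le:
  assumes "simple_graph G" "simple_graph H" "pverts H = pverts G" "parcs G \<subseteq> parcs H"
  shows "threshold_dimension G \<le> metric_dimension H"
  unfolding threshold_dimension_def
  by (rule Least_le) (use assms spanning_with_proj_iff in blast)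

lemma threshold_dimension_attained:
  assumes "simple_graph G"
  obtains H where "simple_graph H" "pverts H = pverts G" "parcs G \<subseteq> parcs H"
    "metric_dimension H = threshold_dimension G"
proof -
  have "\<exists>m H. simple_graph H \<and> spanning (with_proj G) (with_proj H) \<and> metric_dimension H = m"
    using assms spanning_with_proj_iff by blast
  from LeastI_ex[OF this] show ?thesis
    using that spanning_with_proj_iff[OF assms] unfolding threshold_dimension_def by blast
qed

section \<open>The function f\<close>

lemma f_threshold_greater: "x < 2 ^ f_threshold x + real (f_threshold x)"
proof -
  obtain d where "x < 2 ^ d" using real_arch_pow[of 2 x] by auto
  then have "\<exists>d. 2 ^ d + real d > x" by (intro exI[of _ d]) simp
  from LeastI_ex[OF this] show ?thesis by (simp add: f_threshold_def)
qed

text \<open>Since \<open>2 ^ d + d\<close> increases with \<open>d\<close>, the exponents that fail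
  are exactly those below the least one that succeeds.\<close>

lemma less_f_threshold_iff: "d < f_threshold x \<longleftrightarrow> 2 ^ d + real d \<le> x"
proof
  assume "d < f_threshold x"
  then have "\<not> 2 ^ d + real d > x"
    unfolding f_threshold_def by (rule not_less_Least)
  then show "2 ^ d + real d \<le> x" by simp
next
  assume *: "2 ^ d + real d \<le> x"
  show "d < f_threshold x"
  proof (rule ccontr)
    assume "\<not> d < f_threshold x"
    then have "(2::real) ^ f_threshold x + real (f_threshold x) \<le> 2 ^ d + real d"
      by (intro add_mono power_increasing) auto
    with * f_threshold_greater[of x] show False by simp
  qed
qed

lemma f_threshold_nat:
  assumes "m \<ge> 1"
  shows "f_threshold (real m) \<ge> 1"
    and "2 ^ (f_threshold (real m) - 1) + (f_threshold (real m) - 1) \<le> m"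
    and "m < 2 ^ f_threshold (real m) + f_threshold (real m)"
proof -
  have cast: "(2 ^ d + real d \<le> real m) \<longleftrightarrow> 2 ^ d + d \<le> m" for d
    by (metis of_nat_add of_nat_le_iff of_nat_numeral of_nat_power)
  show 1: "f_threshold (real m) \<ge> 1"
    using less_f_threshold_iff[of 0 "real m"] assms by simp
  show "2 ^ (f_threshold (real m) - 1) + (f_threshold (real m) - 1) \<le> m"
    using less_f_threshold_iff[of "f_threshold (real m) - 1" "real m"] 1
      cast[of "f_threshold (real m) - 1"] by linarith
  show "m < 2 ^ f_threshold (real m) + f_threshold (real m)"
    using less_f_threshold_iff[of "f_threshold (real m)" "real m"] cast by simp
qed

text \<open>The left side is the line through the values of \<open>2 ^ a\<close> at
  \<open>a = F\<close> and \<open>a = F + 1\<close>; by convexity it stays below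
  \<open>2 ^ a\<close> at every natural number. From \<open>F\<close> on this is Bernoulli's
  inequality; before \<open>F\<close> the line is nonpositive.\<close>

lemma two_power_tangent: "(2::int) ^ F * (1 + int a - int F) \<le> 2 ^ a"
proof (cases "F \<le> a")
  case True
  then obtain b where b: "a = F + b" using le_Suc_ex by blast
  have "1 + int b \<le> 2 ^ b"
    using Bernoulli_inequality[of "1::real" b] by (smt (verit) of_int_le_iff of_int_of_nat_eq of_int_add of_int_1 of_int_power of_int_numeral)
  then show ?thesis by (simp add: b power_add)
next
  case False
  then have "(2::int) ^ F * (1 + int a - int F) \<le> 0"
    by (intro mult_nonneg_nonpos) auto
  also have "\<dots> \<le> 2 ^ a" by simp
  finally show ?thesis .
qed

lemma sum_less_if_sum_power_less:
  fixes a :: "'i \<Rightarrow> nat"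
  assumes "finite I" and "(\<Sum>i\<in>I. 2 ^ a i + a i) < card I * (2 ^ F + F)"
  shows "sum a I < card I * F"
proof (rule ccontr)
  assume "\<not> sum a I < card I * F"
  then have *: "int (card I * F) \<le> (\<Sum>i\<in>I. int (a i))"
    by (metis not_less of_nat_le_iff of_nat_sum)
  \<comment> \<open>The factor \<open>2 ^ F + 1\<close> is the slope of the line bounding
    \<open>2 ^ a + a\<close> from below; its correction term is nonnegative if the
    \<open>a i\<close> average at least \<open>F\<close>.\<close>
  have "int (card I * (2 ^ F + F)) \<le>
      int (card I * (2 ^ F + F)) + (2 ^ F + 1) * ((\<Sum>i\<in>I. int (a i)) - int (card I * F))"
    using * by simp
  also have "\<dots> = (\<Sum>i\<in>I. 2 ^ F * (1 + int (a i) - int F) + int (a i))"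
    by (simp add: sum.distrib sum_subtractf sum_distrib_left sum_distrib_right algebra_simps)
  also have "\<dots> \<le> (\<Sum>i\<in>I. 2 ^ a i + int (a i))"
    by (intro sum_mono add_right_mono two_power_tangent)
  also have "\<dots> = int (\<Sum>i\<in>I. 2 ^ a i + a i)" by simp
  finally show False using assms(2) by linarith
qed

section \<open>The upper bound\<close>

lemma threshold_dimension_le_card:
  assumes G: "simple_graph G"
    and c: "\<And>u v. (u, v) \<in> parcs G \<Longrightarrow> c u \<noteq> c v"
    and W: "W \<subseteq> pverts G"
    and N: "\<And>u. u \<in> pverts G - W \<Longrightarrow> N u \<subset> {w \<in> W. c w = c u}"
    and inj: "\<And>u v. u \<in> pverts G - W \<Longrightarrow> v \<in> pverts G - W \<Longrightarrow> c u = c v \<Longrightarrow>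
      N u = N v \<Longrightarrow> u = v"
  shows "threshold_dimension G \<le> card W"
proof -
  \<comment> \<open>A non-landmark \<open>u\<close> is joined to exactly the landmarks in
    \<open>N u\<close> within its own colour. Two landmarks of one colour are not joined, nor are
    two non-landmarks.\<close>
  define H where "H = \<lparr>pverts = pverts G,
    parcs = {(u, v). u \<in> pverts G \<and> v \<in> pverts G \<and>
      (c u \<noteq> c v \<or> u \<notin> W \<and> v \<in> N u \<or> v \<notin> W \<and> u \<in> N v)}\<rparr>"
  have pH [simp]: "pverts H = pverts G" by (simp add: H_def)
  have H: "simple_graph H"
    using simple_graphD(2,3)[OF G] N by (intro simple_graphI) (fastforce simp: H_def)+
  have sub: "parcs G \<subseteq> parcs H"
    using simple_graphD(4,5)[OF G] c by (auto simp: H_def)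
  have adj: "(u, w) \<in> parcs H \<longleftrightarrow> c u \<noteq> c w \<or> w \<in> N u"
    if "u \<in> pverts G - W" "w \<in> W" for u w
    using that W by (auto simp: H_def)
  have "resolving_set H W"
  proof (rule resolving_setI_adjacency[OF H])
    show "W \<subseteq> pverts H" using W by simp
    fix u v assume "u \<in> pverts H - W" "v \<in> pverts H - W" and ne: "u \<noteq> v"
    then have uv: "u \<in> pverts G - W" "v \<in> pverts G - W" by auto
    show "\<exists>w \<in> W. (u, w) \<in> parcs H \<longleftrightarrow> (v, w) \<notin> parcs H"
    proof (cases "c u = c v")
      case True
      then have "N u \<noteq> N v" using inj uv ne by blast
      then obtain w where w: "w \<in> N u \<longleftrightarrow> w \<notin> N v" by blast
      then have "w \<in> W" "c w = c u" using N[OF uv(1)] N[OF uv(2)] True by auto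
      with w show ?thesis using adj uv True by metis
    next
      case False
      \<comment> \<open>Proper inclusion leaves a landmark of the colour of \<open>u\<close> that
        \<open>u\<close> misses; \<open>v\<close> has another colour and is joined to it.\<close>
      from N[OF uv(1)] obtain w where w: "w \<in> W" "c w = c u" "w \<notin> N u" by blast
      with False have "(u, w) \<notin> parcs H" "(v, w) \<in> parcs H" using adj uv by auto
      with w show ?thesis by blast
    qed
  qed
  from metric_dimension_le[OF this] threshold_dimension_le[OF G H pH sub]
  show ?thesis by simp
qed

lemma threshold_dimension_le_sum_f_threshold:
  assumes G: "simple_graph G"
    and c: "\<And>u v. (u, v) \<in> parcs G \<Longrightarrow> c u \<noteq> c v"
  shows "threshold_dimension G \<le>
    (\<Sum>i \<in> c ` pverts G. f_threshold (card {v \<in> pverts G. c v = i}))"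
proof -
  define V where "V i = {v \<in> pverts G. c v = i}" for i
  define I where "I = c ` pverts G"
  have fin: "finite (V i)" for i using simple_graphD(2)[OF G] by (simp add: V_def)
  have "\<exists>W g. W \<subseteq> V i \<and> card W = f_threshold (card (V i)) \<and>
      inj_on g (V i - W) \<and> g ` (V i - W) \<subseteq> Pow W - {W}" if "i \<in> I" for i
  proof -
    have "V i \<noteq> {}" using that by (auto simp: I_def V_def)
    then have m: "card (V i) \<ge> 1" using fin[of i] by (simp add: Suc_leI card_gt_0_iff)
    define e where "e = f_threshold (real (card (V i)))"
    note f = f_threshold_nat[OF m, folded e_def]
    \<comment> \<open>This ensures that the class has \<open>e\<close> vertices to choose as
      landmarks.\<close>
    have "e - 1 < 2 ^ (e - 1)" by (rule less_exp)
    with f(1,2) have "e \<le> card (V i)" by linarith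
    then obtain W where W: "W \<subseteq> V i" "card W = e" by (metis obtain_subset_with_card_n)
    have finW: "finite W" using W(1) fin by (rule finite_subset)
    have "card (V i - W) = card (V i) - e" using W finW by (simp add: card_Diff_subset)
    \<comment> \<open>The defining inequality of \<open>f_threshold\<close> leaves no more vertices
      than there are proper subsets of \<open>W\<close>.\<close>
    also have "\<dots> \<le> 2 ^ e - 1" using f(3) by simp
    also have "\<dots> = card (Pow W - {W})" using W finW by (simp add: card_Pow)
    finally obtain g where "g ` (V i - W) \<subseteq> Pow W - {W}" "inj_on g (V i - W)"
      using card_le_inj[of "V i - W" "Pow W - {W}"] fin finW by auto
    with W show ?thesis unfolding e_def by blast
  qed
  then obtain W g where Wg: "\<And>i. i \<in> I \<Longrightarrow> W i \<subseteq> V i \<and> card (W i) = f_threshold (card (V i)) \<and>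
      inj_on (g i) (V i - W i) \<and> g i ` (V i - W i) \<subseteq> Pow (W i) - {W i}"
    by metis
  define WW where "WW = (\<Union>i\<in>I. W i)"
  have W_V: "W i \<subseteq> V i" if "i \<in> I" for i using Wg[OF that] by blast
  then have cW: "c w = i" "w \<in> pverts G" if "i \<in> I" "w \<in> W i" for w i
    using that by (auto simp: V_def)
  have WW: "{w \<in> WW. c w = i} = W i" if "i \<in> I" for i
    using cW(1) that by (auto simp: WW_def)
  have in_V: "c u \<in> I \<and> u \<in> V (c u) - W (c u)" if "u \<in> pverts G - WW" for u
    using that by (auto simp: I_def V_def WW_def)
  have "threshold_dimension G \<le> card WW"
  proof (rule threshold_dimension_le_card[OF G c])
    show "WW \<subseteq> pverts G" using cW(2) by (auto simp: WW_def)
    show "g (c u) u \<subset> {w \<in> WW. c w = c u}" if "u \<in> pverts G - WW" for u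
      using in_V[OF that] Wg[of "c u"] WW[of "c u"] by blast
    show "u = v" if "u \<in> pverts G - WW" "v \<in> pverts G - WW" "c u = c v"
      "g (c u) u = g (c v) v" for u v
      using in_V[OF that(1)] in_V[OF that(2)] Wg[of "c u"] that(3,4)
      by (metis inj_onD)
  qed
  also have "card WW \<le> (\<Sum>i\<in>I. card (W i))"
    unfolding WW_def using simple_graphD(2)[OF G] by (intro card_UN_le) (simp add: I_def)
  also have "\<dots> = (\<Sum>i\<in>I. f_threshold (card (V i)))"
    using Wg by (intro sum.cong) auto
  finally show ?thesis by (simp add: I_def V_def)
qed

lemma chromatic_number_attained:
  assumes "simple_graph G"
  obtains c where "proper_coloring G (chromatic_number G) c"
    "c ` pverts G = {..<chromatic_number G}"
proof -
  obtain h :: "'a \<Rightarrow> nat" where h: "inj_on h (pverts G)" "h ` pverts G = {..<card (pverts G)}"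
    using ex_bij_betw_finite_nat[OF simple_graphD(2)[OF assms]]
    by (auto simp: bij_betw_def atLeast0LessThan)
  then have "proper_coloring G (card (pverts G)) h"
    using simple_graphD(4-6)[OF assms] by (fastforce simp: proper_coloring_def dest: inj_onD)
  then have "\<exists>k c. proper_coloring G k c" by blast
  from LeastI_ex[OF this] obtain c where c: "proper_coloring G (chromatic_number G) c"
    unfolding chromatic_number_def by blast
  have "c ` pverts G = {..<chromatic_number G}"
  proof (rule card_subset_eq)
    show sub: "c ` pverts G \<subseteq> {..<chromatic_number G}"
      using c by (simp add: proper_coloring_def)
    define m where "m = card (c ` pverts G)"
    obtain r where r: "inj_on r (c ` pverts G)" "r ` c ` pverts G = {..<m}"
      using ex_bij_betw_finite_nat[of "c ` pverts G"] simple_graphD(2)[OF assms]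
      by (auto simp: bij_betw_def atLeast0LessThan m_def)
    have "proper_coloring G m (r \<circ> c)"
      using c r simple_graphD(4,5)[OF assms]
      by (fastforce simp: proper_coloring_def image_comp dest: inj_onD)
    then have "chromatic_number G \<le> m"
      unfolding chromatic_number_def by (auto intro: Least_le)
    then show "card (c ` pverts G) = card {..<chromatic_number G}"
      using card_mono[OF _ sub] by (simp add: m_def)
  qed simp
  with c show ?thesis by (rule that)
qed

lemma threshold_dimension_upper:
  assumes G: "simple_graph G"
  shows "int (threshold_dimension G) \<le> int (chromatic_number G) *
    (int (f_threshold (real (order_of G) / real (chromatic_number G))) + 1) - 1"
proof -
  define k where "k = chromatic_number G"
  obtain c where c: "proper_coloring G k c" and img: "c ` pverts G = {..<k}"
    using chromatic_number_attained[OF G] unfolding k_def by metis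
  have fin: "finite (pverts G)" using simple_graphD(2)[OF G] .
  have k: "k \<ge> 1" using img simple_graphD(3)[OF G] by (cases k) auto
  define m where "m i = card {v \<in> pverts G. c v = i}" for i
  have m: "m i \<ge> 1" if "i < k" for i
  proof -
    have "i \<in> c ` pverts G" using img that by simp
    then have "{v \<in> pverts G. c v = i} \<noteq> {}" by auto
    then show ?thesis using fin by (simp add: m_def Suc_leI card_gt_0_iff)
  qed
  have summ: "(\<Sum>i<k. m i) = order_of G"
    using sum.group[of "pverts G" "{..<k}" c "\<lambda>_. 1::nat"] fin img
    by (simp add: m_def order_of_def)
  define F where "F = f_threshold (real (order_of G) / real k)"
  have "real (order_of G) < real k * (2 ^ F + real F)"
    using f_threshold_greater[of "real (order_of G) / real k"] k
    by (simp add: F_def field_simps)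
  then have "real (order_of G) < real (k * (2 ^ F + F))" by simp
  then have n: "order_of G < k * (2 ^ F + F)" unfolding of_nat_less_iff .
  \<comment> \<open>The largest exponent with \<open>2 ^ a i + a i \<le> m i\<close>; the class
    sizes sum to the order, which bounds the sum of the \<open>a i\<close>.\<close>
  define a where "a i = f_threshold (real (m i)) - 1" for i
  have "(\<Sum>i<k. 2 ^ a i + a i) \<le> (\<Sum>i<k. m i)"
    unfolding a_def using f_threshold_nat(2)[OF m] by (intro sum_mono) auto
  then have "sum a {..<k} < k * F"
    using sum_less_if_sum_power_less[of "{..<k}" a F] summ n by simp
  moreover have "threshold_dimension G \<le> (\<Sum>i<k. f_threshold (real (m i)))"
    using threshold_dimension_le_sum_f_threshold[OF G, of c] c
    by (fastforce simp: proper_coloring_def img m_def)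
  moreover have "(\<Sum>i<k. f_threshold (real (m i))) = (\<Sum>i<k. a i + 1)"
    unfolding a_def using f_threshold_nat(1)[OF m] by (intro sum.cong) fastforce+
  \<comment> \<open>Strictness here yields the final \<open>- 1\<close>.\<close>
  ultimately have "threshold_dimension G < k * F + k" by (simp only: sum.distrib) simp
  then have "int (threshold_dimension G) < int (k * F + k)" by (simp only: of_nat_less_iff)
  then show ?thesis unfolding k_def[symmetric] F_def[symmetric] by (simp add: algebra_simps)
qed

section \<open>Sharpness\<close>

text \<open>Landmarks outside \<open>A\<close> are adjacent to all of \<open>A\<close>, so those
  inside must separate \<open>A - W\<close>, and they do so by adjacency. Unlike in the construction
  above, a vertex may see all of \<open>A \<inter> W\<close>, so every subset counts.\<close>

lemma card_le_resolving_part: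
  assumes H: "simple_graph H" and W: "resolving_set H W" and A: "A \<subseteq> pverts H"
    and inner: "\<And>u w. u \<in> A \<Longrightarrow> w \<in> A \<Longrightarrow> u \<noteq> w \<Longrightarrow> gdist H u w \<in> {1, 2}"
    and outer: "\<And>u w. u \<in> A \<Longrightarrow> w \<in> pverts H - A \<Longrightarrow> (u, w) \<in> parcs H"
  shows "card A \<le> 2 ^ card (A \<inter> W) + card (A \<inter> W)"
proof -
  have fin: "finite A" using A simple_graphD(2)[OF H] finite_subset by blast
  define S where "S u = {w \<in> A \<inter> W. gdist H u w = 1}" for u
  have "inj_on S (A - W)"
  proof (rule inj_onI, rule ccontr)
    fix u v assume uv: "u \<in> A - W" "v \<in> A - W" "S u = S v" "u \<noteq> v"
    then obtain w where w: "w \<in> W" "gdist H u w \<noteq> gdist H v w"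
      using W A unfolding resolving_set_def resolves_def by blast
    have ne: "u \<noteq> w" "v \<noteq> w" using uv w by auto
    have wH: "w \<in> pverts H" using W w by (auto simp: resolving_set_def)
    have "w \<in> A"
    proof (rule ccontr)
      assume "w \<notin> A"
      then have "gdist H u w = 1" "gdist H v w = 1"
        using outer uv wH ne by (auto simp: gdist_eq_one_iff[OF H])
      with w show False by simp
    qed
    then have "gdist H u w = 1 \<longleftrightarrow> gdist H v w = 1" using uv(3) w by (auto simp: S_def)
    moreover have "gdist H u w \<in> {1, 2}" "gdist H v w \<in> {1, 2}"
      using inner uv \<open>w \<in> A\<close> ne by auto
    ultimately show False using w(2) by auto
  qed
  moreover have "S ` (A - W) \<subseteq> Pow (A \<inter> W)" by (auto simp: S_def)
  ultimately have "card (A - W) \<le> card (Pow (A \<inter> W))"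
    using fin by (intro card_inj_on_le) auto
  also have "\<dots> = 2 ^ card (A \<inter> W)" using fin by (subst card_Pow) auto
  finally show ?thesis using card_Int_Diff[OF fin, of W] by simp
qed

text \<open>All parts of size \<open>M\<close>, except for a last one of size \<open>s\<close>.\<close>

definition multipartite :: "nat \<Rightarrow> nat \<Rightarrow> nat \<Rightarrow> nat pair_pre_digraph" where
  "multipartite k M s = \<lparr>pverts = {..<(k - 1) * M + s},
    parcs = {(u, v). u < (k - 1) * M + s \<and> v < (k - 1) * M + s \<and> u div M \<noteq> v div M}\<rparr>"

context
  fixes k M s :: nat
  assumes k: "k \<ge> 1" and s: "s \<ge> 1" "s \<le> M"
begin

lemma simple_graph_multipartite: "simple_graph (multipartite k M s)"
  by (rule simple_graphI) (use s in \<open>auto simp: multipartite_def\<close>)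

text \<open>The bound \<open>s \<le> M\<close> keeps the last part within one block of
  \<open>div M\<close>.\<close>

lemma multipartite_part_less:
  assumes "v < (k - 1) * M + s"
  shows "v div M < k"
proof -
  have "v < k * M" using assms s k by (cases k) auto
  then show ?thesis using s by (simp add: less_mult_imp_div_less)
qed

lemma multipartite_part_vertex: "i < k \<Longrightarrow> i * M < (k - 1) * M + s"
  using s mult_le_mono1[of i "k - 1" M] by linarith

lemma chromatic_number_multipartite: "chromatic_number (multipartite k M s) = k"
  unfolding chromatic_number_def
proof (rule Least_equality)
  have "proper_coloring (multipartite k M s) k (\<lambda>v. v div M)"
    using multipartite_part_less by (auto simp: proper_coloring_def multipartite_def)
  then show "\<exists>c. proper_coloring (multipartite k M s) k c" by blast
next
  fix k' assume "\<exists>c. proper_coloring (multipartite k M s) k' c"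
  then obtain c where c: "proper_coloring (multipartite k M s) k' c" by blast
  \<comment> \<open>The first vertices \<open>i * M\<close> of the parts form a clique of order
    \<open>k\<close>.\<close>
  have "inj_on (\<lambda>i. c (i * M)) {..<k}"
  proof (rule inj_onI, rule ccontr)
    fix i j assume "i \<in> {..<k}" "j \<in> {..<k}" "c (i * M) = c (j * M)" "i \<noteq> j"
    moreover from this have "(i * M, j * M) \<in> parcs (multipartite k M s)"
      using multipartite_part_vertex s by (auto simp: multipartite_def)
    ultimately show False using c by (auto simp: proper_coloring_def)
  qed
  moreover have "(\<lambda>i. c (i * M)) ` {..<k} \<subseteq> {..<k'}"
    using c multipartite_part_vertex by (auto simp: proper_coloring_def multipartite_def)
  ultimately show "k \<le> k'" using card_inj_on_le[of _ "{..<k}" "{..<k'}"] by auto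
qed

lemma multipartite_part_size:
  assumes "i < k"
  shows "card {v. v < (k - 1) * M + s \<and> v div M = i} = (if i = k - 1 then s else M)"
proof -
  have M: "M > 0" using s by simp
  have "{v. v < (k - 1) * M + s \<and> v div M = i} =
      {i * M..<i * M + (if i = k - 1 then s else M)}" (is "?L = ?R")
  proof -
    have "v div M = i \<longleftrightarrow> i * M \<le> v \<and> v < i * M + M" for v
      using M by (metis add.commute div_nat_eqI dividend_less_times_div
        mult.commute mult_Suc_right times_div_less_eq_dividend)
    moreover have "i * M + M \<le> (k - 1) * M" if "i \<noteq> k - 1"
      using mult_le_mono1[of "Suc i" "k - 1" M] assms that by (simp add: add.commute)
    moreover have "(k - 1) * M + s \<le> (k - 1) * M + M" using s by simp
    moreover have "i * M + M \<le> (k - 1) * M + s" if "i \<noteq> k - 1"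
      using calculation(2)[OF that] by linarith
    ultimately show ?thesis by (cases "i = k - 1") fastforce+
  qed
  then show ?thesis by simp
qed

text \<open>Each of the \<open>k - 1\<close> full parts needs \<open>d + 1\<close> landmarks and the
  last one needs \<open>d\<close>.\<close>

lemma resolving_set_multipartite_supergraph:
  assumes "k \<ge> 2" and H: "simple_graph H" "pverts H = pverts (multipartite k M s)"
      "parcs (multipartite k M s) \<subseteq> parcs H"
    and W: "resolving_set H W"
    and large: "2 ^ d + d < M" and small: "2 ^ (d - 1) + (d - 1) < s" and "d \<ge> 1"
  shows "k * (d + 1) - 1 \<le> card W"
proof -
  define n where "n = (k - 1) * M + s"
  define A where "A i = {v. v < n \<and> v div M = i}" for i
  have pH: "pverts H = {..<n}" using H(2) by (simp add: multipartite_def n_def)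
  have arc: "(u, v) \<in> parcs H" if "u < n" "v < n" "u div M \<noteq> v div M" for u v
    using that H(3) by (auto simp: multipartite_def n_def)
  have bound: "card (A i) \<le> 2 ^ card (A i \<inter> W) + card (A i \<inter> W)" if i: "i < k" for i
  proof (rule card_le_resolving_part[OF H(1) W])
    show "A i \<subseteq> pverts H" by (auto simp: A_def pH)
    show "(u, w) \<in> parcs H" if "u \<in> A i" "w \<in> pverts H - A i" for u w
      using that by (auto simp: A_def pH intro: arc)
    show "gdist H u w \<in> {1, 2}" if uw: "u \<in> A i" "w \<in> A i" "u \<noteq> w" for u w
    proof -
      \<comment> \<open>Another part, available because \<open>k \<ge> 2\<close>; its first vertex
        is a common neighbour.\<close>
      define j where "j = (if i = 0 then 1 else 0 :: nat)"
      have j: "j < k" "j \<noteq> i" using \<open>k \<ge> 2\<close> by (auto simp: j_def)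
      have "j * M < n" "(j * M) div M = j"
        using multipartite_part_vertex[OF j(1)] s by (auto simp: n_def)
      then have "(u, j * M) \<in> parcs H" "(j * M, w) \<in> parcs H"
        using uw j by (auto simp: A_def intro!: arc)
      then show ?thesis using gdist_common_neighbour[OF H(1) uw(3)] by blast
    qed
  qed
  have mono: "e < card (A i \<inter> W)" if "i < k" "2 ^ e + e < card (A i)" for i e
  proof (rule ccontr)
    assume "\<not> e < card (A i \<inter> W)"
    then have "(2::nat) ^ card (A i \<inter> W) + card (A i \<inter> W) \<le> 2 ^ e + e"
      by (intro add_mono power_increasing) auto
    with bound[OF that(1)] that(2) show False by simp
  qed
  have size: "card (A i) = (if i = k - 1 then s else M)" if "i < k" for i
    using multipartite_part_size[OF that] by (simp add: A_def n_def)
  have "k * (d + 1) - 1 = (\<Sum>i<k - 1. d + 1) + d"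
    using k by (cases k) auto
  also have "\<dots> \<le> (\<Sum>i<k - 1. card (A i \<inter> W)) + card (A (k - 1) \<inter> W)"
  proof (intro add_mono sum_mono)
    show "d + 1 \<le> card (A i \<inter> W)" if "i \<in> {..<k - 1}" for i
    proof -
      from that have "i < k" "i \<noteq> k - 1" by auto
      then show ?thesis using mono[of i d] size[of i] large by simp
    qed
    show "d \<le> card (A (k - 1) \<inter> W)"
      using mono[of "k - 1" "d - 1"] size[of "k - 1"] small k \<open>d \<ge> 1\<close> by auto
  qed
  also have "\<dots> = (\<Sum>i<k. card (A i \<inter> W))"
    using k by (cases k) auto
  also have "\<dots> = card (\<Union>i<k. A i \<inter> W)"
    by (rule card_UN_disjoint[symmetric]) (auto simp: A_def)
  also have "\<dots> \<le> card W"
    using W simple_graphD(2)[OF H(1)]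
    by (intro card_mono) (auto simp: resolving_set_def intro: finite_subset)
  finally show ?thesis .
qed

end

text \<open>The small last part keeps \<open>n / k\<close> below \<open>2 ^ k + k\<close> although all other parts exceed it.\<close>

lemma f_threshold_multipartite:
  assumes "k \<ge> 1"
  shows "f_threshold (real ((k - 1) * (2 ^ k + k + 1) + (2 ^ (k - 1) + k)) / real k) = k"
proof -
  obtain j where j: "k = Suc j" using assms by (cases k) auto
  define n where "n = (k - 1) * (2 ^ k + k + 1) + (2 ^ (k - 1) + k)"
  \<comment> \<open>Compared with \<open>2 ^ k + k\<close> per part, the full parts have
    \<open>k - 1\<close> extra vertices in total, while the last part lacks
    \<open>2 ^ (k - 1)\<close>.\<close>
  have "k - 1 < 2 ^ (k - 1)" by (rule less_exp)
  then have "n < k * (2 ^ k + k)" by (simp add: n_def j algebra_simps)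
  then have "real n < real (k * (2 ^ k + k))" by (simp only: of_nat_less_iff)
  then have "\<not> 2 ^ k + real k \<le> real n / real k"
    using assms by (simp add: field_simps)
  then have "f_threshold (real n / real k) \<le> k"
    using less_f_threshold_iff[of k "real n / real k"] by linarith
  \<comment> \<open>Every part has at least \<open>2 ^ j + j\<close> vertices.\<close>
  moreover have "k * (2 ^ j + j) \<le> n" by (simp add: n_def j algebra_simps)
  then have "real (k * (2 ^ j + j)) \<le> real n" by (simp only: of_nat_le_iff)
  then have "2 ^ j + real j \<le> real n / real k"
    using assms by (simp add: field_simps)
  then have "j < f_threshold (real n / real k)" by (simp only: less_f_threshold_iff)
  ultimately show ?thesis unfolding n_def[symmetric] using j by simp
qed

text \<open>The part sizes exceed \<open>2 ^ d + d\<close> and \<open>2 ^ (d - 1) + (d - 1)\<close>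
  by one at \<open>d = k\<close>, because the bound for a single part is not strict.\<close>

lemma threshold_dimension_sharp:
  assumes k: "k \<ge> 1"
  defines "G \<equiv> multipartite k (2 ^ k + k + 1) (2 ^ (k - 1) + k)"
  shows "simple_graph G" "chromatic_number G = k"
    "int (threshold_dimension G) = int k * (int (f_threshold (real (order_of G) / real k)) + 1) - 1"
proof -
  have s: "(2::nat) ^ (k - 1) + k \<ge> 1" "(2::nat) ^ (k - 1) + k \<le> 2 ^ k + k + 1"
    using power_increasing[of "k - 1" k "2::nat"] k by linarith+
  show G: "simple_graph G" unfolding G_def by (rule simple_graph_multipartite[OF k s])
  show chi: "chromatic_number G = k"
    unfolding G_def by (rule chromatic_number_multipartite[OF k s])
  have f: "f_threshold (real (order_of G) / real k) = k"
    using f_threshold_multipartite[OF k] by (simp add: G_def order_of_def multipartite_def)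
  obtain H where H: "simple_graph H" "pverts H = pverts G" "parcs G \<subseteq> parcs H"
    "metric_dimension H = threshold_dimension G"
    using threshold_dimension_attained[OF G] .
  obtain W where W: "resolving_set H W" "card W = metric_dimension H"
    using metric_dimension_attained[OF H(1)] .
  have "k * (k + 1) - 1 \<le> card W"
  \<comment> \<open>With one part there is no outside common neighbour. The graph then has two
    vertices, and one landmark is required.\<close>
  proof (cases "k = 1")
    case True
    then have "0 \<in> pverts H" "Suc 0 \<in> pverts H"
      using H(2) by (auto simp: G_def multipartite_def)
    then have "W \<noteq> {}" using W(1) by (fastforce simp: resolving_set_def)
    moreover have "finite W"
      using W(1) simple_graphD(2)[OF H(1)] by (auto simp: resolving_set_def intro: finite_subset)
    ultimately show ?thesis using True by (simp add: Suc_leI card_gt_0_iff)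
  next
    case False
    with k have "k \<ge> 2" by simp
    show ?thesis
      by (rule resolving_set_multipartite_supergraph[OF k s \<open>k \<ge> 2\<close> H(1) _ _ W(1)])
        (use H(2,3) k in \<open>auto simp: G_def\<close>)
  qed
  then have "k * (k + 1) \<le> threshold_dimension G + 1" using W(2) H(4) by linarith
  then have "int (k * (k + 1)) \<le> int (threshold_dimension G + 1)" by (simp only: of_nat_le_iff)
  then have "int k * (int k + 1) - 1 \<le> int (threshold_dimension G)" by (simp add: algebra_simps)
  with threshold_dimension_upper[OF G]
  show "int (threshold_dimension G) =
      int k * (int (f_threshold (real (order_of G) / real k)) + 1) - 1"
    unfolding chi f by simp
qed

theorem theorem3p5:
  shows "(\<forall>(G :: 'a pair_pre_digraph) n k.
            simple_graph G \<and> order_of G = n \<and> chromatic_number G = k \<longrightarrow>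
            int (threshold_dimension G) \<le> int k * (int (f_threshold (real n / real k)) + 1) - 1)
       \<and> (\<forall>k \<ge> 1. \<exists>n. \<exists>G :: nat pair_pre_digraph.
            simple_graph G \<and> order_of G = n \<and> chromatic_number G = k \<and>
            int (threshold_dimension G) = int k * (int (f_threshold (real n / real k)) + 1) - 1)"
  using threshold_dimension_upper threshold_dimension_sharp by blast

end
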